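(* Let $\Xi^3$ be a triangle with extreme points $\hat{\xi}^1,\hat{\xi}^2,\hat{\xi}^3$, let $\mathcal{D}$, $\mathcal{F}$, $\mathcal{Q}$ be as in the context with support set $\Xi^3$, let $(\mu_E,\mu_N)\in\Xi^3$, and let $(p_1^*,p_2^*,p_3^* )$ be the unique solution of $$\sum_{k=1}^3\hat{\xi}_E^k p_k=\mu_E,\qquad \sum_{k=1}^3\hat{\xi}_N^k p_k=\mu_N,\qquad \sum_{k=1}^3 p_k=1$$ (which is nonnegative since $(\mu_E,\mu_N)\in\Xi^3$). Then the two-stage distributionally robust problem $$\min_{z\in\mathcal{F}}\ q^{T}z+\sup_{\mathbb{P}\in\mathcal{D}}\mathbb{E}_{\mathbb{P}}\big[\mathcal{Q}(z,\tilde{\xi})\big]$$ is equivalent to the following stochastic program: $$\min_{z\in\mathcal{F},\ x^1,x^2,x^3\in\mathbb{R}^n}\ q^{T}z+\sum_{k=1}^3 p_k^*\,\big(c^{T}x^k\big)\qquad\text{s.t.}\quad A x^k\ge d-B(\hat{\xi}^k)z,\quad \forall k\in\{1,2,3\}.$$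
   Context: $\Xi^3=\mathrm{conv}\{\hat{\xi}^1,\hat{\xi}^2,\hat{\xi}^3\}\subset\mathbb{R}^2$ is a polytope with three extreme points $\hat{\xi}^k=(\hat{\xi}_E^k,\hat{\xi}_N^k)$, $k=1,2,3$. The mean-support ambiguity set $\mathcal{D}$ (with support set $\Xi^3$ and given mean values $(\mu_E,\mu_N)$) is the set of all probability distributions $\mathbb{P}$ of a random vector $\tilde{\xi}=(\tilde{\xi}_E,\tilde{\xi}_N)$ with $\mathbb{P}\{\tilde{\xi}\in\Xi^3\}=1$, $\mathbb{E}_{\mathbb{P}}[\tilde{\xi}_E]=\mu_E$ and $\mathbb{E}_{\mathbb{P}}[\tilde{\xi}_N]=\mu_N$. $z$ is the first-stage decision vector, $\mathcal{F}$ is the first-stage feasible region (that of a mixed-integer second-order cone program), and $q$ is a cost vector. The second-stage problem is a linear program, and $\mathcal{Q}(z,\xi)$ denotes its optimal value: $$\mathcal{Q}(z,\xi)=\min_{x\in\mathcal{X}(z,\xi)} c^{T}x,\qquad \mathcal{X}(z,\xi)=\{x\in\mathbb{R}^n : A x + B(\xi) z \ge d\},$$ where $c\in\mathbb{R}^n$, $A\in\mathbb{R}^{m\times n}$, $d\in\mathbb{R}^m$, and $B(\xi)$ is a matrix with $m$ rows whose entries are affine functions of $\xi$.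
   Formalization: Added assumption: for every z in F and every vertex k with p_k* = 0, the second-stage linear program at that vertex is feasible; otherwise the stochastic program may be infeasible while the robust problem has a finite value. It is vacuous if all p_k* > 0. *)

theory Defs
  imports "HOL-Probability.Probability"
begin

text \<open>Feasible regions of mixed-integer second-order cone programs. A cone constraint with
  \<open>m i = 0\<close> is a linear inequality; two of these give a linear equation.\<close>

definition misocp_region :: "(real^'p) set \<Rightarrow> bool" where
  "misocp_region F \<longleftrightarrow>
     (\<exists>(I :: 'p set) (L :: nat) (m :: nat \<Rightarrow> nat)
        (G :: nat \<Rightarrow> nat \<Rightarrow> real^'p) (g :: nat \<Rightarrow> nat \<Rightarrow> real)
        (h :: nat \<Rightarrow> real^'p) (r :: nat \<Rightarrow> real).
        F = {z. (\<forall>i\<in>I. z $ i \<in> \<int>) \<and>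
                (\<forall>i<L. L2_set (\<lambda>j. G i j \<bullet> z + g i j) {..<m i} \<le> h i \<bullet> z + r i)})"

definition affine_entries :: "(real \<times> real \<Rightarrow> real^'p^'m) \<Rightarrow> bool" where
  "affine_entries B \<longleftrightarrow> (\<forall>i j. \<exists>a b. \<forall>\<xi>. B \<xi> $ i $ j = a \<bullet> \<xi> + b)"

text \<open>Points of the plane are pairs \<open>(\<xi>\<^sub>E, \<xi>\<^sub>N)\<close>; distributions are Borel
  probability measures on the plane. The order on \<open>real^'m\<close> is componentwise.\<close>

definition mean_support_ambiguity ::
    "(real \<times> real) set \<Rightarrow> real \<times> real \<Rightarrow> (real \<times> real) measure set" where
  "mean_support_ambiguity \<Xi> \<mu> =
     {P. prob_space P \<and> sets P = sets borel \<and> measure P \<Xi> = 1 \<and>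
         (\<integral>\<xi>. fst \<xi> \<partial>P) = fst \<mu> \<and> (\<integral>\<xi>. snd \<xi> \<partial>P) = snd \<mu>}"

definition second_stage_feasible ::
    "real^'n^'m \<Rightarrow> (real \<times> real \<Rightarrow> real^'p^'m) \<Rightarrow> real^'m \<Rightarrow> real^'p \<Rightarrow> real \<times> real
      \<Rightarrow> (real^'n) set" where
  "second_stage_feasible A B d z \<xi> = {x. A *v x + B \<xi> *v z \<ge> d}"

text \<open>The optimal value is extended real: \<open>\<infinity>\<close> for an infeasible and \<open>-\<infinity>\<close> for an
  unbounded linear program.\<close>

definition second_stage_value ::
    "real^'n \<Rightarrow> real^'n^'m \<Rightarrow> (real \<times> real \<Rightarrow> real^'p^'m) \<Rightarrow> real^'m \<Rightarrow> real^'p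
      \<Rightarrow> real \<times> real \<Rightarrow> ereal" where
  "second_stage_value c A B d z \<xi> = (INF x\<in>second_stage_feasible A B d z \<xi>. ereal (c \<bullet> x))"

text \<open>Expectation of an extended real random variable, as the difference of the integrals of
  its positive and negative part (\<open>e2ennreal\<close> maps negative numbers to \<open>0\<close>). In type
  \<open>ereal\<close>, \<open>\<infinity> - \<infinity> = \<infinity>\<close>, the usual convention for minimization.\<close>

definition ereal_expectation :: "'a measure \<Rightarrow> ('a \<Rightarrow> ereal) \<Rightarrow> ereal" where
  "ereal_expectation P f =
     enn2ereal (\<integral>\<^sup>+\<omega>. e2ennreal (f \<omega>) \<partial>P) - enn2ereal (\<integral>\<^sup>+\<omega>. e2ennreal (- f \<omega>) \<partial>P)"

definition dro_objective ::
    "real^'p \<Rightarrow> real^'n \<Rightarrow> real^'n^'m \<Rightarrow> (real \<times> real \<Rightarrow> real^'p^'m) \<Rightarrow> real^'m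
      \<Rightarrow> (real \<times> real) measure set \<Rightarrow> real^'p \<Rightarrow> ereal" where
  "dro_objective q c A B d \<D> z =
     ereal (q \<bullet> z) + (SUP P\<in>\<D>. ereal_expectation P (second_stage_value c A B d z))"

definition sp_objective ::
    "real^'p \<Rightarrow> real^'n \<Rightarrow> (3 \<Rightarrow> real) \<Rightarrow> (real^'p) \<times> (3 \<Rightarrow> real^'n) \<Rightarrow> ereal" where
  "sp_objective q c p = (\<lambda>(z, x). ereal (q \<bullet> z + (\<Sum>k\<in>UNIV. p k * (c \<bullet> x k))))"

definition sp_feasible ::
    "(real^'p) set \<Rightarrow> real^'n^'m \<Rightarrow> (real \<times> real \<Rightarrow> real^'p^'m) \<Rightarrow> real^'m
      \<Rightarrow> (3 \<Rightarrow> real \<times> real) \<Rightarrow> ((real^'p) \<times> (3 \<Rightarrow> real^'n)) set" where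
  "sp_feasible F A B d \<xi>h = {(z, x). z \<in> F \<and> (\<forall>k. A *v x k \<ge> d - B (\<xi>h k) *v z)}"

text \<open>The system that determines the weights of the three vertices.\<close>

definition vertex_weights :: "(3 \<Rightarrow> real \<times> real) \<Rightarrow> real \<times> real \<Rightarrow> (3 \<Rightarrow> real) \<Rightarrow> bool" where
  "vertex_weights \<xi>h \<mu> p \<longleftrightarrow>
     (\<Sum>k\<in>UNIV. fst (\<xi>h k) * p k) = fst \<mu> \<and>
     (\<Sum>k\<in>UNIV. snd (\<xi>h k) * p k) = snd \<mu> \<and>
     (\<Sum>k\<in>UNIV. p k) = 1"

text \<open>Optimal solutions have finite objective value: a point of value \<open>\<infinity>\<close> is infeasible, and
  a point of value \<open>-\<infinity>\<close> shows that the problem is unbounded.\<close>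

definition optimal_solution :: "('a \<Rightarrow> ereal) \<Rightarrow> 'a set \<Rightarrow> 'a \<Rightarrow> bool" where
  "optimal_solution f S s \<longleftrightarrow> s \<in> S \<and> \<bar>f s\<bar> \<noteq> \<infinity> \<and> (\<forall>t\<in>S. f s \<le> f t)"

end

theory Submission
  imports Defs
begin

text \<open>Fix \<open>z\<close>. For feasible \<open>x k\<close> at the vertices, the affine function with values \<open>c \<bullet> x k\<close> at
  the vertices majorizes the convex second-stage value on the triangle, and its expectation is
  \<open>\<Sum>k. p k * (c \<bullet> x k)\<close> for every distribution with mean \<open>\<mu>\<close>; hence the robust objective is at
  most the stochastic one. Conversely, the distribution with mass \<open>p k\<close> at the vertex \<open>\<xi>h k\<close>
  belongs to the ambiguity set, and since linear programs with finite value attain it, its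
  expected second-stage value is reached by a choice of the \<open>x k\<close>, unless the value is infinite
  at a vertex of positive weight.\<close>


section \<open>Attainment of the minimum in linear programs\<close>

text \<open>A point at which \<open>c\<close> is not constant along the directions that keep the active constraints
  active can be moved, without increasing \<open>c\<close>, until a further constraint becomes active.\<close>

lemma polyhedral_min_attained:
  fixes a :: "'i \<Rightarrow> 'a::real_inner" and b :: "'i \<Rightarrow> real" and c :: 'a
  assumes fin: "finite I" and S: "S = {x. \<forall>i\<in>I. b i \<le> a i \<bullet> x}"
    and ne: "S \<noteq> {}" and bd: "\<And>x. x \<in> S \<Longrightarrow> m \<le> c \<bullet> x"
  obtains x where "x \<in> S" "\<And>y. y \<in> S \<Longrightarrow> c \<bullet> x \<le> c \<bullet> y"
proof -
  define act where "act x = {i\<in>I. a i \<bullet> x = b i}" for x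
  \<comment> \<open>Basic points take the place of vertices, which a polyhedron containing a line
    does not have: the condition says that \<open>c\<close> lies in the span of the active
    normals.\<close>
  define basic where "basic x \<longleftrightarrow> (\<forall>v. (\<forall>i\<in>act x. a i \<bullet> v = 0) \<longrightarrow> c \<bullet> v = 0)" for x
  have step: "\<exists>y\<in>S. c \<bullet> y \<le> c \<bullet> x \<and> act x \<subset> act y" if x: "x \<in> S" and nb: "\<not> basic x" for x
  proof -
    obtain v0 where v0: "\<forall>i\<in>act x. a i \<bullet> v0 = 0" "c \<bullet> v0 \<noteq> 0"
      using nb by (auto simp: basic_def)
    define v where "v = (if c \<bullet> v0 < 0 then v0 else - v0)"
    have v: "\<forall>i\<in>act x. a i \<bullet> v = 0" "c \<bullet> v < 0"
      using v0 by (auto simp: v_def)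
    define J where "J = {i\<in>I. a i \<bullet> v < 0}"
    have finJ: "finite J" using fin by (simp add: J_def)
    \<comment> \<open>Otherwise \<open>v\<close> is a recession direction of \<open>S\<close> along
      which \<open>c\<close> decreases without bound; the \<open>t\<close> below is long enough to
      push the objective to at most \<open>m - 1\<close>.\<close>
    have "J \<noteq> {}"
    proof
      assume "J = {}"
      then have nn: "0 \<le> a i \<bullet> v" if "i \<in> I" for i
        using that by (force simp: J_def)
      define t where "t = max 0 ((m - 1 - c \<bullet> x) / (c \<bullet> v))"
      have "x + t *\<^sub>R v \<in> S"
        unfolding S mem_Collect_eq
      proof
        fix i assume i: "i \<in> I"
        have "0 \<le> t * (a i \<bullet> v)" using nn[OF i] by (simp add: t_def)
        moreover have "b i \<le> a i \<bullet> x" using x i by (simp add: S)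
        ultimately show "b i \<le> a i \<bullet> (x + t *\<^sub>R v)" by (simp add: inner_add_right)
      qed
      from bd[OF this] have "m \<le> c \<bullet> x + t * (c \<bullet> v)" by (simp add: inner_add_right)
      moreover have "t * (c \<bullet> v) \<le> (m - 1 - c \<bullet> x) / (c \<bullet> v) * (c \<bullet> v)"
        using v(2) by (intro mult_right_mono_neg) (auto simp: t_def)
      ultimately show False using v(2) by simp
    qed
    \<comment> \<open>Ratio test: \<open>r i\<close> is the step length along \<open>v\<close> at
      which constraint \<open>i\<close> becomes tight. The smallest one keeps all constraints valid
      and activates \<open>j\<close>.\<close>
    define r where "r i = (a i \<bullet> x - b i) / (- (a i \<bullet> v))" for i
    define t where "t = Min (r ` J)"
    have "t \<in> r ` J" unfolding t_def using finJ \<open>J \<noteq> {}\<close> by (intro Min_in) auto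
    then obtain j where j: "j \<in> J" "t = r j" by blast
    have tle: "t \<le> r i" if "i \<in> J" for i unfolding t_def using finJ that by (intro Min_le) auto
    have "0 \<le> t"
      unfolding j(2) r_def using j(1) x by (intro divide_nonneg_pos) (auto simp: J_def S)
    define y where "y = x + t *\<^sub>R v"
    have yi: "a i \<bullet> y = a i \<bullet> x + t * (a i \<bullet> v)" for i
      by (simp add: y_def inner_add_right)
    have "y \<in> S"
      unfolding S mem_Collect_eq
    proof
      fix i assume i: "i \<in> I"
      have bi: "b i \<le> a i \<bullet> x" using x i by (simp add: S)
      show "b i \<le> a i \<bullet> y"
      proof (cases "i \<in> J")
        case True
        then have neg: "a i \<bullet> v < 0" by (simp add: J_def)
        have "t * (- (a i \<bullet> v)) \<le> r i * (- (a i \<bullet> v))"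
          using tle[OF True] neg by (intro mult_right_mono) auto
        also have "\<dots> = a i \<bullet> x - b i" using neg by (simp add: r_def)
        finally show ?thesis by (simp add: yi)
      next
        case False
        then have "0 \<le> t * (a i \<bullet> v)" using i \<open>0 \<le> t\<close> by (auto simp: J_def)
        then show ?thesis using bi by (simp add: yi)
      qed
    qed
    moreover have "c \<bullet> y \<le> c \<bullet> x"
      using v(2) \<open>0 \<le> t\<close> by (simp add: y_def inner_add_right mult_nonneg_nonpos)
    moreover have "act x \<subseteq> act y" using v(1) by (auto simp: act_def yi)
    moreover have "j \<in> act y" "j \<notin> act x"
      using j v(1) by (auto simp: act_def yi r_def J_def)
    ultimately show ?thesis by blast
  qed
  have dom: "\<exists>y\<in>S. basic y \<and> c \<bullet> y \<le> c \<bullet> x" if "x \<in> S" for x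
    using that
  \<comment> \<open>Each step enlarges the active set strictly, so the number of inactive
    constraints serves as measure.\<close>
  proof (induction "card I - card (act x)" arbitrary: x rule: less_induct)
    case less
    show ?case
    proof (cases "basic x")
      case True
      then show ?thesis using less.prems by blast
    next
      case False
      from step[OF less.prems False] obtain y where
        y: "y \<in> S" "c \<bullet> y \<le> c \<bullet> x" "act x \<subset> act y" by blast
      have "act y \<subseteq> I" by (auto simp: act_def)
      then have "card (act x) < card (act y)" "card (act y) \<le> card I"
        using y(3) fin by (auto intro: psubset_card_mono card_mono finite_subset)
      then have "card I - card (act y) < card I - card (act x)" by simp
      from less.hyps[OF this y(1)] y(2) show ?thesis by force
    qed
  qed
  define T where "T = {x\<in>S. basic x}"
  \<comment> \<open>On basic points the objective is a function of the active set, so it takes finitely many values.\<close>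
  have same: "c \<bullet> x = c \<bullet> y" if "x \<in> T" "act x = act y" for x y
  proof -
    have "\<forall>i\<in>act x. a i \<bullet> (x - y) = 0"
      using that(2) by (auto simp: act_def inner_diff_right)
    then have "c \<bullet> (x - y) = 0" using that(1) by (auto simp: T_def basic_def)
    then show ?thesis by (simp add: inner_diff_right)
  qed
  \<comment> \<open>The representative chosen by \<open>SOME\<close> may lie outside
    \<open>T\<close> and even outside \<open>S\<close>; \<open>same\<close> asks only one of the two
    points to be in \<open>T\<close>.\<close>
  have "(\<bullet>) c ` T \<subseteq> (\<lambda>J. c \<bullet> (SOME y. act y = J)) ` Pow I"
  proof
    fix w assume "w \<in> (\<bullet>) c ` T"
    then obtain x where x: "x \<in> T" "w = c \<bullet> x" by blast
    have "act (SOME y. act y = act x) = act x" by (rule someI) simp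
    then have "w = c \<bullet> (SOME y. act y = act x)" using same x by metis
    moreover have "act x \<in> Pow I" by (auto simp: act_def)
    ultimately show "w \<in> (\<lambda>J. c \<bullet> (SOME y. act y = J)) ` Pow I" by blast
  qed
  then have finT: "finite ((\<bullet>) c ` T)" by (rule finite_subset) (simp add: fin)
  have "T \<noteq> {}" using ne dom by (fastforce simp: T_def)
  then have "Min ((\<bullet>) c ` T) \<in> (\<bullet>) c ` T" using finT by (intro Min_in) auto
  then obtain x where x: "x \<in> T" "c \<bullet> x = Min ((\<bullet>) c ` T)" by auto
  show ?thesis
  proof
    show "x \<in> S" using x by (simp add: T_def)
    fix y assume "y \<in> S"
    from dom[OF this] obtain w where w: "w \<in> T" "c \<bullet> w \<le> c \<bullet> y" by (auto simp: T_def)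
    have "c \<bullet> x \<le> c \<bullet> w" using x w finT by auto
    then show "c \<bullet> x \<le> c \<bullet> y" using w by simp
  qed
qed

section \<open>Affine interpolation at affinely independent points\<close>

text \<open>Moving one point \<open>a\<close> of \<open>S\<close> to the origin makes the remaining
  differences linearly independent, so a linear map can be prescribed on them; the constant
  \<open>b\<close> then corrects the value at \<open>a\<close>.\<close>

lemma affine_independent_interpolation:
  fixes S :: "'a::real_vector set" and t :: "'a \<Rightarrow> real"
  assumes "\<not> affine_dependent S"
  obtains f :: "'a \<Rightarrow> real" and b where "linear f" "\<And>x. x \<in> S \<Longrightarrow> f x + b = t x"
proof (cases "S = {}")
  case True
  then show ?thesis using that[of "\<lambda>_. 0" 0] by (simp add: linear_zero)
next
  case False
  then obtain a where a: "a \<in> S" by blast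
  define S' where "S' = S - {a}"
  have S: "S = insert a S'" "a \<notin> S'" using a by (auto simp: S'_def)
  have "independent ((\<lambda>x. x - a) ` S')"
    using assms S affine_dependent_iff_dependent[of a S'] by (simp add: image_def algebra_simps)
  from linear_independent_extend[OF this, of "\<lambda>y. t (y + a) - t a"]
  obtain f where f: "linear f" "\<forall>y\<in>(\<lambda>x. x - a) ` S'. f y = t (y + a) - t a" by blast
  show ?thesis
  proof (rule that[OF f(1)])
    fix x assume "x \<in> S"
    then show "f x + (t a - f a) = t x"
      using f(2) S by (auto simp: linear_diff[OF f(1)])
  qed
qed

text \<open>Of three distinct collinear points one lies strictly between the other two and hence is
  not extreme.\<close>

lemma extreme_points_triangle_affine_independent:
  fixes a b c :: "'a::euclidean_space"
  assumes "a \<noteq> b" "b \<noteq> c" "a \<noteq> c"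
    and "\<And>x. x \<in> {a, b, c} \<Longrightarrow> x extreme_point_of (convex hull {a, b, c})"
  shows "\<not> affine_dependent {a, b, c}"
proof
  assume "affine_dependent {a, b, c}"
  then have "collinear {a, b, c}" using collinear_3_eq_affine_dependent by blast
  then have "a \<in> open_segment b c \<or> b \<in> open_segment c a \<or> c \<in> open_segment a b"
    using assms(1-3) by (auto simp: collinear_between_cases between_mem_segment open_segment_def)
  moreover have "{a, b, c} \<subseteq> convex hull {a, b, c}" by (rule hull_subset)
  ultimately show False using assms(4) unfolding extreme_point_of_def by blast
qed

section \<open>Extended real expectations\<close>

text \<open>No measurability is needed, since \<open>nn_integral\<close> is monotone on all functions. So the
  second-stage value need not be shown to be measurable.\<close>

lemma ereal_expectation_mono_AE:
  assumes "AE \<omega> in P. f \<omega> \<le> g \<omega>"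
  shows "ereal_expectation P f \<le> ereal_expectation P g"
  unfolding ereal_expectation_def
proof (rule ereal_minus_mono)
  show "enn2ereal (\<integral>\<^sup>+ \<omega>. e2ennreal (f \<omega>) \<partial>P) \<le> enn2ereal (\<integral>\<^sup>+ \<omega>. e2ennreal (g \<omega>) \<partial>P)"
    unfolding less_eq_ennreal.rep_eq[symmetric] using assms
    by (intro nn_integral_mono_AE) (auto elim!: eventually_mono intro: e2ennreal_mono)
  show "enn2ereal (\<integral>\<^sup>+ \<omega>. e2ennreal (- g \<omega>) \<partial>P) \<le> enn2ereal (\<integral>\<^sup>+ \<omega>. e2ennreal (- f \<omega>) \<partial>P)"
    unfolding less_eq_ennreal.rep_eq[symmetric] using assms
    by (intro nn_integral_mono_AE) (auto elim!: eventually_mono intro: e2ennreal_mono)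
qed

text \<open>Integrability makes the integrals of both parts finite, so the \<open>ereal\<close>
  difference is an ordinary real one and no infinity convention interferes.\<close>

lemma ereal_expectation_ereal:
  assumes "integrable P g"
  shows "ereal_expectation P (\<lambda>\<omega>. ereal (g \<omega>)) = ereal (\<integral>\<omega>. g \<omega> \<partial>P)"
proof -
  have fin: "(\<integral>\<^sup>+ \<omega>. ennreal (g \<omega>) \<partial>P) \<noteq> \<infinity>" "(\<integral>\<^sup>+ \<omega>. ennreal (- g \<omega>) \<partial>P) \<noteq> \<infinity>"
    using assms by (auto simp: real_integrable_def)
  then obtain r s where "(\<integral>\<^sup>+ \<omega>. ennreal (g \<omega>) \<partial>P) = ennreal r" "(\<integral>\<^sup>+ \<omega>. ennreal (- g \<omega>) \<partial>P) = ennreal s"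
     "0 \<le> r" "0 \<le> s"
    by (metis ennreal_cases infinity_ennreal_def)
  then show ?thesis
    using real_lebesgue_integral_def[OF assms]
    by (simp add: ereal_expectation_def e2ennreal_ereal enn2ereal_ennreal)
qed


section \<open>Barycentric weights of the triangle\<close>

lemma triangle_interpolation:
  fixes \<xi>h :: "3 \<Rightarrow> 'a::euclidean_space" and t :: "3 \<Rightarrow> real"
  assumes "inj \<xi>h" "\<And>k. \<xi>h k extreme_point_of (convex hull (range \<xi>h))"
  obtains f b where "linear f" "\<And>k. f (\<xi>h k) + b = t k"
proof -
  have r: "range \<xi>h = {\<xi>h 1, \<xi>h 2, \<xi>h 3}" by (auto simp: UNIV_3)
  have "\<not> affine_dependent (range \<xi>h)"
    unfolding r
  proof (rule extreme_points_triangle_affine_independent)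
    show "\<xi>h 1 \<noteq> \<xi>h 2" "\<xi>h 2 \<noteq> \<xi>h 3" "\<xi>h 1 \<noteq> \<xi>h 3"
      using assms(1) by (simp_all add: inj_eq)
  qed (use assms(2) r in auto)
  then obtain f :: "'a \<Rightarrow> real" and b where "linear f" "\<And>x. x \<in> range \<xi>h \<Longrightarrow> f x + b = (t \<circ> inv \<xi>h) x"
    by (rule affine_independent_interpolation[where t = "t \<circ> inv \<xi>h"]) blast
  then show ?thesis using assms(1) by (intro that[of f b]) auto
qed

lemma vertex_weights_iff:
  "vertex_weights \<xi>h \<mu> p \<longleftrightarrow> (\<Sum>k\<in>UNIV. p k *\<^sub>R \<xi>h k) = \<mu> \<and> (\<Sum>k\<in>UNIV. p k) = 1"
  unfolding vertex_weights_def prod_eq_iff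
  by (simp add: fst_sum snd_sum mult.commute)

lemma vertex_weights_affine:
  assumes "vertex_weights \<xi>h \<mu> p" "linear f"
  shows "(\<Sum>k\<in>UNIV. p k * (f (\<xi>h k) + b)) = f \<mu> + b"
proof -
  have "f \<mu> = (\<Sum>k\<in>UNIV. p k * f (\<xi>h k))"
    using assms by (auto simp: vertex_weights_iff linear_sum linear_scale)
  moreover have "(\<Sum>k\<in>UNIV. p k * b) = b"
    using assms(1) by (simp add: vertex_weights_iff flip: sum_distrib_right)
  ultimately show ?thesis by (simp add: distrib_left sum.distrib)
qed

text \<open>The affine function that is 1 at vertex \<open>j\<close> and 0 at the others is the
  \<open>j\<close>-th barycentric coordinate; its value at \<mu> is the weight of \<open>j\<close>
  in every solution.\<close>

lemma vertex_weights_unique: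
  assumes "inj \<xi>h" "\<And>k. \<xi>h k extreme_point_of (convex hull (range \<xi>h))"
    and "vertex_weights \<xi>h \<mu> p" "vertex_weights \<xi>h \<mu> p'"
  shows "p = p'"
proof
  fix j
  obtain f and b :: real where f: "linear f" "\<And>k. f (\<xi>h k) + b = (if k = j then 1 else 0)"
    by (rule triangle_interpolation[OF assms(1,2), where t = "\<lambda>k. if k = j then 1 else 0"]) (rule that)
  have "(\<Sum>k\<in>UNIV. p k * (f (\<xi>h k) + b)) = (\<Sum>k\<in>UNIV. p' k * (f (\<xi>h k) + b))"
    using vertex_weights_affine[OF assms(3) f(1)] vertex_weights_affine[OF assms(4) f(1)] by simp
  then show "p j = p' j" by (simp add: f(2) sum.delta' if_distrib cong: if_cong)
qed

text \<open>Weights from the convex hull are attached to points; injectivity of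
  \<open>\<xi>h\<close> moves them to the index type.\<close>

lemma vertex_weights_nonneg_exists:
  assumes "inj \<xi>h" "\<mu> \<in> convex hull (range \<xi>h)"
  obtains u where "\<And>k. 0 \<le> u k" "vertex_weights \<xi>h \<mu> u"
proof -
  obtain u where u: "\<forall>x\<in>range \<xi>h. 0 \<le> u x" "sum u (range \<xi>h) = 1" "(\<Sum>x\<in>range \<xi>h. u x *\<^sub>R x) = \<mu>"
    using assms(2) by (auto simp: convex_hull_finite)
  show ?thesis
    by (rule that[of "u \<circ> \<xi>h"]) (use u assms(1) in \<open>auto simp: vertex_weights_iff sum.reindex\<close>)
qed

section \<open>Distributions in the ambiguity set\<close>

lemma mean_support_ambiguity_affine:
  assumes P: "P \<in> mean_support_ambiguity \<Xi> \<mu>" and "compact \<Xi>"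
    and f: "linear (f :: real \<times> real \<Rightarrow> real)"
  shows "integrable P (\<lambda>\<xi>. f \<xi> + b)" "(\<integral>\<xi>. f \<xi> + b \<partial>P) = f \<mu> + b" "AE \<xi> in P. \<xi> \<in> \<Xi>"
proof -
  interpret prob_space P using P by (simp add: mean_support_ambiguity_def)
  have sP [measurable_cong]: "sets P = sets borel" using P by (simp add: mean_support_ambiguity_def)
  have "\<Xi> \<in> sets P" using \<open>compact \<Xi>\<close> by (simp add: sP borel_compact)
  then show AE: "AE \<xi> in P. \<xi> \<in> \<Xi>"
    using P by (subst prob_eq_1[symmetric]) (auto simp: mean_support_ambiguity_def)
  obtain K where K: "\<And>\<xi>. \<xi> \<in> \<Xi> \<Longrightarrow> norm \<xi> \<le> K"
    using compact_imp_bounded[OF \<open>compact \<Xi>\<close>] by (auto simp: bounded_iff)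
  \<comment> \<open>The Bochner integral of a non-integrable function is 0 by default, so the moment
    equations alone do not give integrability; the bounded support does.\<close>
  have int: "integrable P (\<lambda>\<xi>. \<xi>)"
    by (rule integrable_const_bound[where B = K]) (use AE K in \<open>auto elim!: eventually_mono\<close>)
  have "(\<integral>\<xi>. \<xi> \<partial>P) = \<mu>"
    using P integral_bounded_linear[OF bounded_linear_fst int]
      integral_bounded_linear[OF bounded_linear_snd int]
    by (simp add: mean_support_ambiguity_def prod_eq_iff)
  moreover have bl: "bounded_linear f" using f by (simp add: linear_conv_bounded_linear)
  ultimately have "(\<integral>\<xi>. f \<xi> \<partial>P) = f \<mu>" "integrable P f"
    using integral_bounded_linear[OF bl int] integrable_bounded_linear[OF bl int] by auto
  then show "integrable P (\<lambda>\<xi>. f \<xi> + b)" "(\<integral>\<xi>. f \<xi> + b \<partial>P) = f \<mu> + b"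
    by (simp_all add: prob_space)
qed

text \<open>This is the worst-case distribution. The atom bound serves the case of an infinite
  vertex value, the last property the case of finite ones. The bound is an inequality because
  coinciding vertices would pool their weights.\<close>

lemma vertex_distribution:
  assumes p: "\<And>k. 0 \<le> p k" "vertex_weights \<xi>h \<mu> p"
  obtains P where "P \<in> mean_support_ambiguity (convex hull (range \<xi>h)) \<mu>"
    "\<And>k. ennreal (p k) \<le> emeasure P {\<xi>h k}" "AE \<xi> in P. \<exists>k. 0 < p k \<and> \<xi> = \<xi>h k"
proof -
  define \<pi> where "\<pi> = embed_pmf p"
  have "(\<integral>\<^sup>+ k. ennreal (p k) \<partial>count_space UNIV) = 1"
    using p by (simp add: nn_integral_count_space_finite vertex_weights_def)
  then have pmf: "pmf \<pi> k = p k" for k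
    unfolding \<pi>_def using p(1) by (intro pmf_embed_pmf) auto
  define P where "P = distr (measure_pmf \<pi>) borel \<xi>h"
  interpret prob_space P unfolding P_def by (rule measure_pmf.prob_space_distr) simp
  have hull: "convex hull (range \<xi>h) \<in> sets borel"
    by (intro borel_compact compact_convex_hull finite_imp_compact) simp
  show ?thesis
  proof
    show AE: "AE \<xi> in P. \<exists>k. 0 < p k \<and> \<xi> = \<xi>h k"
      unfolding P_def
    proof (subst AE_distr_iff)
      have "{\<xi>. \<exists>k. 0 < p k \<and> \<xi> = \<xi>h k} = \<xi>h ` {k. 0 < p k}" by auto
      then show "{\<xi> \<in> space borel. \<exists>k. 0 < p k \<and> \<xi> = \<xi>h k} \<in> sets borel"
        by (simp add: borel_closed finite_imp_closed)
      show "AE k in \<pi>. \<exists>k'. 0 < p k' \<and> \<xi>h k = \<xi>h k'"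
        by (auto simp: AE_measure_pmf_iff set_pmf_iff pmf intro!: exI order.not_eq_order_implies_strict p(1))
    qed simp
    show "ennreal (p k) \<le> emeasure P {\<xi>h k}" for k
    proof -
      have "ennreal (p k) = emeasure (measure_pmf \<pi>) {k}" by (simp add: emeasure_pmf_single pmf)
      also have "\<dots> \<le> emeasure (measure_pmf \<pi>) (\<xi>h -` {\<xi>h k})" by (intro emeasure_mono) auto
      also have "\<dots> = emeasure P {\<xi>h k}" unfolding P_def by (subst emeasure_distr) auto
      finally show ?thesis .
    qed
    have "AE \<xi> in P. \<xi> \<in> convex hull (range \<xi>h)"
      using AE by eventually_elim (auto intro: hull_inc)
    then have "measure P (convex hull (range \<xi>h)) = 1"
      using hull by (subst prob_eq_1) (auto simp: P_def)
    moreover have "(\<integral>\<xi>. g \<xi> \<partial>P) = (\<Sum>k\<in>UNIV. g (\<xi>h k) * p k)"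
      if "g \<in> borel_measurable borel" for g :: "real \<times> real \<Rightarrow> real"
      unfolding P_def using that
      by (simp add: integral_distr integral_measure_pmf_real[where A = UNIV] pmf)
    ultimately show "P \<in> mean_support_ambiguity (convex hull (range \<xi>h)) \<mu>"
      using p(2) prob_space_axioms
      by (simp add: mean_support_ambiguity_def vertex_weights_def borel_measurable_continuous_onI
          continuous_on_fst continuous_on_snd) (simp add: P_def)
  qed
qed

section \<open>The second-stage linear program\<close>

text \<open>Weights with sum 1 pass through the affine entries of \<open>B\<close>, constants
  included, and nonnegative weights preserve the inequalities. This is the source of the convexity
  of the second-stage value in \<xi>.\<close>

lemma second_stage_feasible_convex:
  assumes B: "affine_entries B" and u: "\<And>k. k \<in> K \<Longrightarrow> 0 \<le> u k" "sum u K = 1"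
    and x: "\<And>k. k \<in> K \<Longrightarrow> x k \<in> second_stage_feasible A B d z (\<xi> k)"
  shows "(\<Sum>k\<in>K. u k *\<^sub>R x k) \<in> second_stage_feasible A B d z (\<Sum>k\<in>K. u k *\<^sub>R \<xi> k)"
proof -
  have "B (\<Sum>k\<in>K. u k *\<^sub>R \<xi> k) $ i $ j = (\<Sum>k\<in>K. u k * B (\<xi> k) $ i $ j)" for i j
  proof -
    obtain a b where ab: "\<And>\<xi>. B \<xi> $ i $ j = a \<bullet> \<xi> + b"
      using B unfolding affine_entries_def by blast
    have "(\<Sum>k\<in>K. u k * b) = b" using u(2) by (simp flip: sum_distrib_right)
    then show ?thesis by (simp add: ab inner_sum_right distrib_left sum.distrib)
  qed
  then have "B (\<Sum>k\<in>K. u k *\<^sub>R \<xi> k) *v z = (\<Sum>k\<in>K. u k *\<^sub>R (B (\<xi> k) *v z))"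
    by (simp add: vec_eq_iff matrix_vector_mult_def sum_distrib_left sum_distrib_right mult.assoc)
      (intro allI sum.swap)
  moreover have "A *v (\<Sum>k\<in>K. u k *\<^sub>R x k) = (\<Sum>k\<in>K. u k *\<^sub>R (A *v x k))"
    by (simp add: linear_sum linear_scale)
  ultimately have "A *v (\<Sum>k\<in>K. u k *\<^sub>R x k) + B (\<Sum>k\<in>K. u k *\<^sub>R \<xi> k) *v z
      = (\<Sum>k\<in>K. u k *\<^sub>R (A *v x k + B (\<xi> k) *v z))"
    by (simp add: scaleR_add_right sum.distrib)
  moreover have "d = (\<Sum>k\<in>K. u k *\<^sub>R d)" using u(2) by (simp flip: scaleR_sum_left)
  moreover have "(\<Sum>k\<in>K. u k *\<^sub>R d) \<le> (\<Sum>k\<in>K. u k *\<^sub>R (A *v x k + B (\<xi> k) *v z))"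
    using u(1) x unfolding less_eq_vec_def
    by (auto intro!: sum_mono mult_left_mono simp: second_stage_feasible_def less_eq_vec_def)
  ultimately show ?thesis by (simp add: second_stage_feasible_def)
qed

lemma second_stage_attained:
  assumes ne: "second_stage_feasible A B d z \<xi> \<noteq> {}"
    and fin: "second_stage_value c A B d z \<xi> \<noteq> - \<infinity>"
  obtains x where "x \<in> second_stage_feasible A B d z \<xi>" "second_stage_value c A B d z \<xi> = ereal (c \<bullet> x)"
proof -
  let ?S = "second_stage_feasible A B d z \<xi>"
  obtain m where "ereal m \<le> second_stage_value c A B d z \<xi>"
    using fin by (cases "second_stage_value c A B d z \<xi>") auto
  then have m: "m \<le> c \<bullet> x" if "x \<in> ?S" for x
    using that by (auto simp: second_stage_value_def le_INF_iff)
  \<comment> \<open>The rows of \<open>A\<close> are the constraint normals of a finite system, the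
    form that \<open>polyhedral_min_attained\<close> expects.\<close>
  have S: "?S = {x. \<forall>i\<in>UNIV. (d - B \<xi> *v z) $ i \<le> A $ i \<bullet> x}"
    by (simp add: second_stage_feasible_def less_eq_vec_def matrix_vector_mul_component algebra_simps)
  obtain x where x: "x \<in> ?S" "\<And>y. y \<in> ?S \<Longrightarrow> c \<bullet> x \<le> c \<bullet> y"
    using polyhedral_min_attained[OF finite S ne m] by blast
  show ?thesis
  proof (rule that[OF x(1)])
    show "second_stage_value c A B d z \<xi> = ereal (c \<bullet> x)"
      unfolding second_stage_value_def using x
      by (intro antisym INF_greatest INF_lower) auto
  qed
qed


section \<open>Comparison of the two objectives\<close>

lemma sp_feasible_iff:
  "(z, x) \<in> sp_feasible F A B d \<xi>h \<longleftrightarrow> z \<in> F \<and> (\<forall>k. x k \<in> second_stage_feasible A B d z (\<xi>h k))"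
  by (simp add: sp_feasible_def second_stage_feasible_def diff_le_eq)

lemma dro_objective_le_sp_objective:
  assumes inj: "inj \<xi>h" and ext: "\<And>k. \<xi>h k extreme_point_of (convex hull (range \<xi>h))"
    and p: "vertex_weights \<xi>h \<mu> p" and B: "affine_entries B"
    and x: "(z, x) \<in> sp_feasible F A B d \<xi>h"
  shows "dro_objective q c A B d (mean_support_ambiguity (convex hull (range \<xi>h)) \<mu>) z
    \<le> sp_objective q c p (z, x)"
proof -
  let ?\<Xi> = "convex hull (range \<xi>h)" and ?\<phi> = "second_stage_value c A B d z"
  obtain f b where f: "linear f" "\<And>k. f (\<xi>h k) + b = c \<bullet> x k"
    by (rule triangle_interpolation[OF inj ext, where t = "\<lambda>k. c \<bullet> x k"]) (rule that)
  \<comment> \<open>The barycentric weights of \<xi> combine the vertices and the decisions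
    \<open>x k\<close> alike: the combined decision is feasible at \<xi>, and its cost is the
    interpolated value.\<close>
  have le: "?\<phi> \<xi> \<le> ereal (f \<xi> + b)" if \<xi>: "\<xi> \<in> ?\<Xi>" for \<xi>
  proof -
    obtain u where u: "\<And>k. 0 \<le> u k" "vertex_weights \<xi>h \<xi> u"
      by (rule vertex_weights_nonneg_exists[OF inj \<xi>]) (rule that)
    have "(\<Sum>k\<in>UNIV. u k *\<^sub>R x k) \<in> second_stage_feasible A B d z (\<Sum>k\<in>UNIV. u k *\<^sub>R \<xi>h k)"
      using u x by (intro second_stage_feasible_convex B) (auto simp: sp_feasible_iff vertex_weights_iff)
    then have "?\<phi> \<xi> \<le> ereal (c \<bullet> (\<Sum>k\<in>UNIV. u k *\<^sub>R x k))"
      using u(2) unfolding second_stage_value_def by (intro INF_lower) (simp add: vertex_weights_iff)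
    also have "c \<bullet> (\<Sum>k\<in>UNIV. u k *\<^sub>R x k) = f \<xi> + b"
      using vertex_weights_affine[OF u(2) f(1), of b] by (simp add: f(2) inner_sum_right)
    finally show ?thesis .
  qed
  have "ereal_expectation P ?\<phi> \<le> ereal (\<Sum>k\<in>UNIV. p k * (c \<bullet> x k))"
    if P: "P \<in> mean_support_ambiguity ?\<Xi> \<mu>" for P
  proof -
    have "compact ?\<Xi>" by (intro compact_convex_hull finite_imp_compact) simp
    note E = mean_support_ambiguity_affine(1,2)[OF P this f(1), of b]
      and AE = mean_support_ambiguity_affine(3)[OF P this f(1)]
    have "ereal_expectation P ?\<phi> \<le> ereal_expectation P (\<lambda>\<xi>. ereal (f \<xi> + b))"
      using AE by (intro ereal_expectation_mono_AE) (auto elim!: eventually_mono intro: le)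
    also have "\<dots> = ereal (f \<mu> + b)" using E by (simp add: ereal_expectation_ereal)
    also have "f \<mu> + b = (\<Sum>k\<in>UNIV. p k * (c \<bullet> x k))"
      using vertex_weights_affine[OF p f(1), of b] by (simp add: f(2))
    finally show ?thesis .
  qed
  then have "(SUP P\<in>mean_support_ambiguity ?\<Xi> \<mu>. ereal_expectation P ?\<phi>)
      \<le> ereal (\<Sum>k\<in>UNIV. p k * (c \<bullet> x k))"
    by (intro SUP_least)
  then have "ereal (q \<bullet> z) + (SUP P\<in>mean_support_ambiguity ?\<Xi> \<mu>. ereal_expectation P ?\<phi>)
      \<le> ereal (q \<bullet> z) + ereal (\<Sum>k\<in>UNIV. p k * (c \<bullet> x k))"
    by (rule add_left_mono)
  then show ?thesis by (simp add: dro_objective_def sp_objective_def)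
qed

text \<open>Only the block \<open>x k\<close> is replaced. Since its weight is positive and its cost
  unbounded below, it outweighs the fixed remaining cost.\<close>

lemma sp_objective_unbounded:
  assumes feas: "(z, x) \<in> sp_feasible F A B d \<xi>h"
    and k: "0 < p k" "second_stage_value c A B d z (\<xi>h k) = - \<infinity>"
  shows "(INF x\<in>{x. (z, x) \<in> sp_feasible F A B d \<xi>h}. sp_objective q c p (z, x)) = - \<infinity>"
proof (rule ereal_bot)
  fix r :: real
  \<comment> \<open>\<open>s\<close> is the first-stage cost plus the cost of the other two blocks,
    so \<open>(r - s) / p k\<close> is the threshold for block \<open>k\<close> that brings the
    total down to \<open>r\<close>.\<close>
  define s where "s = q \<bullet> z + (\<Sum>j\<in>UNIV - {k}. p j * (c \<bullet> x j))"
  have "second_stage_value c A B d z (\<xi>h k) < ereal ((r - s) / p k)" using k(2) by simp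
  then obtain y where y: "y \<in> second_stage_feasible A B d z (\<xi>h k)" "c \<bullet> y < (r - s) / p k"
    unfolding second_stage_value_def INF_less_iff by auto
  have "(z, x(k := y)) \<in> sp_feasible F A B d \<xi>h"
    using feas y(1) by (simp add: sp_feasible_iff)
  then have "(INF x\<in>{x. (z, x) \<in> sp_feasible F A B d \<xi>h}. sp_objective q c p (z, x))
      \<le> sp_objective q c p (z, x(k := y))"
    by (intro INF_lower) simp
  also have "\<dots> = ereal (s + p k * (c \<bullet> y))"
    by (simp add: sp_objective_def s_def sum.remove[of UNIV k])
  also have "\<dots> \<le> ereal r" using y(2) k(1) by (simp add: field_simps)
  finally show "(INF x\<in>{x. (z, x) \<in> sp_feasible F A B d \<xi>h}. sp_objective q c p (z, x)) \<le> ereal r" .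
qed

text \<open>In the first two outcomes the stochastic infimum is trivially at most the robust value;
  the third provides an explicit witness, from which optimal solutions can be transferred as
  well.\<close>

lemma dro_objective_cases:
  assumes inj: "inj \<xi>h" and ext: "\<And>k. \<xi>h k extreme_point_of (convex hull (range \<xi>h))"
    and p: "vertex_weights \<xi>h \<mu> p" "\<And>k. 0 \<le> p k"
    and z: "z \<in> F"
    and recourse: "\<And>k. p k = 0 \<Longrightarrow> second_stage_feasible A B d z (\<xi>h k) \<noteq> {}"
  obtains
    (infeasible) "dro_objective q c A B d (mean_support_ambiguity (convex hull (range \<xi>h)) \<mu>) z = \<infinity>"
  | (unbounded) "(INF x\<in>{x. (z, x) \<in> sp_feasible F A B d \<xi>h}. sp_objective q c p (z, x)) = - \<infinity>"
  | (attained) x where "(z, x) \<in> sp_feasible F A B d \<xi>h"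
      "sp_objective q c p (z, x)
        \<le> dro_objective q c A B d (mean_support_ambiguity (convex hull (range \<xi>h)) \<mu>) z"
proof -
  let ?\<Xi> = "convex hull (range \<xi>h)" and ?\<phi> = "second_stage_value c A B d z"
  obtain P where P: "P \<in> mean_support_ambiguity ?\<Xi> \<mu>"
    and atom: "\<And>k. ennreal (p k) \<le> emeasure P {\<xi>h k}"
    and AE: "AE \<xi> in P. \<exists>k. 0 < p k \<and> \<xi> = \<xi>h k"
    by (rule vertex_distribution[OF p(2,1)]) (rule that)
  have sup: "ereal_expectation P ?\<phi> \<le> (SUP P\<in>mean_support_ambiguity ?\<Xi> \<mu>. ereal_expectation P ?\<phi>)"
    using P by (rule SUP_upper)
  \<comment> \<open>An infinite value at a vertex of positive weight is treated first: it prevails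
    over a value of minus infinity elsewhere, by the convention \<infinity> - \<infinity> =
    \<infinity>. Its absence in \<open>bot\<close> leaves every vertex program feasible.\<close>
  consider (inf) k where "0 < p k" "?\<phi> (\<xi>h k) = \<infinity>"
    | (bot) k where "0 < p k" "?\<phi> (\<xi>h k) = - \<infinity>" "\<And>k. 0 < p k \<Longrightarrow> ?\<phi> (\<xi>h k) \<noteq> \<infinity>"
    | (fin) "\<And>k. 0 < p k \<Longrightarrow> ?\<phi> (\<xi>h k) \<noteq> - \<infinity>" "\<And>k. 0 < p k \<Longrightarrow> ?\<phi> (\<xi>h k) \<noteq> \<infinity>"
    by blast
  then show ?thesis
  proof cases
    case inf
    have "sets P = sets borel" using P by (simp add: mean_support_ambiguity_def)
    then have "(\<integral>\<^sup>+ \<xi>. \<infinity> * indicator {\<xi>h k} \<xi> \<partial>P) = \<infinity> * emeasure P {\<xi>h k}"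
      by (intro nn_integral_cmult_indicator) simp
    moreover have "0 < emeasure P {\<xi>h k}"
      using atom[of k] inf(1) by (meson ennreal_less_zero_iff less_le_trans)
    ultimately have "(\<integral>\<^sup>+ \<xi>. \<infinity> * indicator {\<xi>h k} \<xi> \<partial>P) = \<infinity>"
      by (simp add: ennreal_top_mult)
    moreover have "(\<integral>\<^sup>+ \<xi>. \<infinity> * indicator {\<xi>h k} \<xi> \<partial>P) \<le> (\<integral>\<^sup>+ \<xi>. e2ennreal (?\<phi> \<xi>) \<partial>P)"
      using inf(2) by (intro nn_integral_mono) (auto split: split_indicator)
    ultimately have "ereal_expectation P ?\<phi> = \<infinity>"
      by (simp add: ereal_expectation_def top_unique)
    then show ?thesis using sup by (intro infeasible) (simp add: dro_objective_def)
  next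
    case bot
    have "second_stage_feasible A B d z (\<xi>h k) \<noteq> {}" for k
    proof (cases "p k = 0")
      case False
      then have "?\<phi> (\<xi>h k) \<noteq> \<infinity>" using bot(3) p(2)[of k] by simp
      then show ?thesis by (auto simp: second_stage_value_def top_ereal_def)
    qed (rule recourse)
    then have "\<exists>y. y \<in> second_stage_feasible A B d z (\<xi>h k)" for k by blast
    then obtain x where "\<And>k. x k \<in> second_stage_feasible A B d z (\<xi>h k)" by metis
    then show ?thesis using z bot(1,2)
      by (intro unbounded sp_objective_unbounded) (auto simp: sp_feasible_iff)
  next
    case fin
    \<comment> \<open>At a vertex of weight 0 any feasible decision will do, since its cost is
      multiplied by 0.\<close>
    have "\<exists>y\<in>second_stage_feasible A B d z (\<xi>h k). 0 < p k \<longrightarrow> ?\<phi> (\<xi>h k) = ereal (c \<bullet> y)" for k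
    proof (cases "p k = 0")
      case True
      then show ?thesis using recourse[of k] by auto
    next
      case False
      then have "0 < p k" using p(2)[of k] by simp
      then have "second_stage_feasible A B d z (\<xi>h k) \<noteq> {}"
        using fin(2)[of k] by (auto simp: second_stage_value_def top_ereal_def)
      then show ?thesis using fin(1)[OF \<open>0 < p k\<close>] by (metis second_stage_attained)
    qed
    then obtain x where x: "\<And>k. x k \<in> second_stage_feasible A B d z (\<xi>h k)"
      "\<And>k. 0 < p k \<Longrightarrow> ?\<phi> (\<xi>h k) = ereal (c \<bullet> x k)"
      by metis
    \<comment> \<open>Here the interpolant agrees with the second-stage value at every vertex
      charged by \<open>P\<close>, hence almost everywhere, so its expectation can be computed in
      place of that of the value.\<close>
    obtain f b where f: "linear f" "\<And>k. f (\<xi>h k) + b = c \<bullet> x k"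
      by (rule triangle_interpolation[OF inj ext, where t = "\<lambda>k. c \<bullet> x k"]) (rule that)
    have "compact ?\<Xi>" by (intro compact_convex_hull finite_imp_compact) simp
    note E = mean_support_ambiguity_affine(1,2)[OF P this f(1), of b]
    have "(\<Sum>k\<in>UNIV. p k * (c \<bullet> x k)) = f \<mu> + b"
      using vertex_weights_affine[OF p(1) f(1), of b] by (simp add: f(2))
    also have "ereal \<dots> = ereal_expectation P (\<lambda>\<xi>. ereal (f \<xi> + b))"
      using E by (simp add: ereal_expectation_ereal)
    also have "\<dots> \<le> ereal_expectation P ?\<phi>"
      using AE by (intro ereal_expectation_mono_AE) (auto elim!: eventually_mono simp: f(2) x(2))
    finally have "ereal (q \<bullet> z) + ereal (\<Sum>k\<in>UNIV. p k * (c \<bullet> x k))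
        \<le> ereal (q \<bullet> z) + (SUP P\<in>mean_support_ambiguity ?\<Xi> \<mu>. ereal_expectation P ?\<phi>)"
      using sup by (intro add_left_mono) simp
    then show ?thesis
      using x(1) z by (intro attained[of x]) (simp_all add: sp_feasible_iff dro_objective_def sp_objective_def)
  qed
qed

theorem mainTheorem4:
  fixes \<xi>h :: "3 \<Rightarrow> real \<times> real"
    and \<mu> :: "real \<times> real"
    and p :: "3 \<Rightarrow> real"
    and F :: "(real^'p) set"
    and q :: "real^'p"
    and c :: "real^'n"
    and A :: "real^'n^'m"
    and B :: "real \<times> real \<Rightarrow> real^'p^'m"
    and d :: "real^'m"
    and \<Xi> :: "(real \<times> real) set"
    and \<D> :: "(real \<times> real) measure set"
  assumes triangle: "\<Xi> = convex hull (range \<xi>h)" "inj \<xi>h" "\<forall>k. \<xi>h k extreme_point_of \<Xi>"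
    and ambiguity: "\<D> = mean_support_ambiguity \<Xi> \<mu>"
    and mean: "\<mu> \<in> \<Xi>"
    and weights: "vertex_weights \<xi>h \<mu> p"
    and first_stage: "misocp_region F"
    and affine_B: "affine_entries B"
    \<comment> \<open>The stochastic program constrains \<open>x k\<close> even if the vertex \<open>\<xi>h k\<close> has weight \<open>0\<close>
      and is invisible to \<open>\<D>\<close>; without feasibility at such vertices the equivalence fails.
      Relatively complete recourse implies this assumption, and so does \<open>\<forall>k. p k \<noteq> 0\<close>.\<close>
    and recourse: "\<forall>z\<in>F. \<forall>k. p k = 0 \<longrightarrow> second_stage_feasible A B d z (\<xi>h k) \<noteq> {}"
  shows "(\<exists>!p'. vertex_weights \<xi>h \<mu> p') \<and> (\<forall>k. 0 \<le> p k) \<and>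
    (\<forall>z\<in>F. dro_objective q c A B d \<D> z =
       (INF x\<in>{x. (z, x) \<in> sp_feasible F A B d \<xi>h}. sp_objective q c p (z, x))) \<and>
    (INF z\<in>F. dro_objective q c A B d \<D> z) =
       (INF zx\<in>sp_feasible F A B d \<xi>h. sp_objective q c p zx) \<and>
    (\<forall>z. optimal_solution (dro_objective q c A B d \<D>) F z \<longleftrightarrow>
       (\<exists>x. optimal_solution (sp_objective q c p) (sp_feasible F A B d \<xi>h) (z, x)))"
proof -
  let ?S = "sp_feasible F A B d \<xi>h" and ?D = "dro_objective q c A B d \<D>"
    and ?O = "sp_objective q c p"
  let ?V = "\<lambda>z. INF x\<in>{x. (z, x) \<in> ?S}. ?O (z, x)"
  have ext: "\<xi>h k extreme_point_of (convex hull (range \<xi>h))" for k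
    using triangle by blast
  have D: "\<D> = mean_support_ambiguity (convex hull (range \<xi>h)) \<mu>"
    using ambiguity triangle(1) by simp
  note unique = vertex_weights_unique[OF triangle(2) ext]
  obtain u where "\<And>k. 0 \<le> u k" "vertex_weights \<xi>h \<mu> u"
    using vertex_weights_nonneg_exists[OF triangle(2)] mean triangle(1) by metis
  \<comment> \<open>By uniqueness \<open>p\<close> is the convex-combination weight vector
    \<open>u\<close> of \<mu>.\<close>
  then have nonneg: "0 \<le> p k" for k using unique[OF weights] by metis
  have le: "?D z \<le> ?O (z, x)" if "(z, x) \<in> ?S" for z x
    unfolding D by (rule dro_objective_le_sp_objective[OF triangle(2) ext weights affine_B that])
  have cases: "?D z = \<infinity> \<or> ?V z = - \<infinity> \<or> (\<exists>x. (z, x) \<in> ?S \<and> ?O (z, x) \<le> ?D z)"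
    if z: "z \<in> F" for z
  proof -
    have rec: "\<And>k. p k = 0 \<Longrightarrow> second_stage_feasible A B d z (\<xi>h k) \<noteq> {}"
      using recourse z by blast
    show ?thesis
      by (rule dro_objective_cases[OF triangle(2) ext weights nonneg z rec, of q c])
        (unfold D, blast+)
  qed
  have val: "?D z = ?V z" if z: "z \<in> F" for z
  proof (rule antisym)
    show "?D z \<le> ?V z" using le by (intro INF_greatest) simp
    show "?V z \<le> ?D z" using cases[OF z] by (auto intro: INF_lower2)
  qed
  have F: "z \<in> F" if "(z, x) \<in> ?S" for z x using that by (simp add: sp_feasible_iff)
  have INF: "(INF z\<in>F. ?D z) = (INF zx\<in>?S. ?O zx)"
  proof (rule antisym)
    show "(INF z\<in>F. ?D z) \<le> (INF zx\<in>?S. ?O zx)"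
    proof (intro INF_greatest, clarify)
      fix z x assume "(z, x) \<in> ?S"
      then show "(INF z\<in>F. ?D z) \<le> ?O (z, x)" by (intro INF_lower2[of z]) (auto intro: F le)
    qed
    show "(INF zx\<in>?S. ?O zx) \<le> (INF z\<in>F. ?D z)"
    proof (rule INF_greatest)
      fix z assume "z \<in> F"
      have "(INF zx\<in>?S. ?O zx) \<le> ?V z" by (rule INF_greatest) (auto intro: INF_lower)
      then show "(INF zx\<in>?S. ?O zx) \<le> ?D z" using val[OF \<open>z \<in> F\<close>] by simp
    qed
  qed
  have opt: "optimal_solution ?D F z \<longleftrightarrow> (\<exists>x. optimal_solution ?O ?S (z, x))" for z
  proof
    assume o: "optimal_solution ?D F z"
    then have z: "z \<in> F" "\<bar>?D z\<bar> \<noteq> \<infinity>" by (auto simp: optimal_solution_def)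
    \<comment> \<open>Finiteness of \<open>?D z\<close> excludes the first case directly and the
      second through \<open>val\<close>, so only the attained case remains.\<close>
    then obtain x where x: "(z, x) \<in> ?S" "?O (z, x) \<le> ?D z"
      using cases[OF z(1)] val[OF z(1)] by auto
    \<comment> \<open>The chain runs from \<open>?O (z, x)\<close> through \<open>?D z\<close> and
      \<open>?D z'\<close> to \<open>?O (z', x')\<close>.\<close>
    have "?O (z, x) \<le> ?O (z', x')" if "(z', x') \<in> ?S" for z' x'
      using x(2) o F[OF that] le[OF that] by (auto simp: optimal_solution_def intro: order_trans)
    moreover have "\<bar>?O (z, x)\<bar> \<noteq> \<infinity>" by (simp add: sp_objective_def)
    ultimately show "\<exists>x. optimal_solution ?O ?S (z, x)"
      using x(1) by (auto simp: optimal_solution_def)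
  next
    assume "\<exists>x. optimal_solution ?O ?S (z, x)"
    then obtain x where x: "(z, x) \<in> ?S" "\<bar>?O (z, x)\<bar> \<noteq> \<infinity>" "\<And>t. t \<in> ?S \<Longrightarrow> ?O (z, x) \<le> ?O t"
      by (auto simp: optimal_solution_def)
    \<comment> \<open>\<open>val\<close> turns \<open>?D z'\<close> into an infimum over the slice
      of \<open>?S\<close> at \<open>z'\<close>; for an empty slice it is \<infinity>.\<close>
    have lower: "?O (z, x) \<le> ?D z'" if "z' \<in> F" for z'
      unfolding val[OF that] by (rule INF_greatest) (simp add: x(3))
    have "?D z = ?O (z, x)" using le[OF x(1)] lower[OF F[OF x(1)]] by (rule antisym)
    then show "optimal_solution ?D F z"
      using x(2) F[OF x(1)] lower by (simp add: optimal_solution_def)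
  qed
  show ?thesis
    using weights unique nonneg val INF opt by blast
qed

end
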